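(* Fix positive integers $R,\delta$ with $R\ge 2\delta+1$. Then $\chi(Z(m,R,\delta)) > 2^{\frac{R-2\delta-4}{2}} \log^{(2\delta)}m + o(1)$ as $m \rightarrow \infty$.
   Context: $\log^{(j)}$ is the base-2 logarithm iterated $j$ times. $Z(m,R,\delta)$ is the graph whose vertices are the tuples $\langle\alpha,A_1,\dots,A_\delta\rangle$ with $\alpha\in A_1\subseteq\cdots\subseteq A_\delta\subseteq[m]$, $|A_i|=2i+1$ for $1\le i\le\delta-1$ and $|A_\delta|=R$; two vertices $\langle\alpha,A_1,\dots,A_\delta\rangle$, $\langle\beta,B_1,\dots,B_\delta\rangle$ are adjacent iff $\alpha\neq\beta$, $\alpha\in B_1$, $\beta\in A_1$, and $A_i\subseteq B_{i+1}$, $B_i\subseteq A_{i+1}$ for all $1\le i\le\delta-1$. The $o(1)$ term denotes a function of $m$ (for fixed $R,\delta$) tending to $0$ as $m\to\infty$. *)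

theory Defs
  imports Complex_Main "HOL-Library.FuncSet" "Graph_Theory.Pair_Digraph"
begin

text \<open>
  Simple graphs are the \<open>pair_graph\<close>s of the AFP entry Graph Theory: finite, loop-free, and
  with each edge represented by both of its orientations.
\<close>

definition proper_coloring :: "'a pair_pre_digraph \<Rightarrow> nat \<Rightarrow> ('a \<Rightarrow> nat) \<Rightarrow> bool" where
  "proper_coloring G k c \<longleftrightarrow>
     (\<forall>v\<in>pverts G. c v \<in> {1..k}) \<and> (\<forall>(u, v)\<in>parcs G. c u \<noteq> c v)"

text \<open>The \<open>LEAST\<close> is attained for every \<open>pair_graph\<close>; see \<open>chromatic_number_attained\<close>.\<close>

definition chromatic_number :: "'a pair_pre_digraph \<Rightarrow> nat" where
  "chromatic_number G = (LEAST k. \<exists>c. proper_coloring G k c)"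

text \<open>
  The chain \<open>A\<^sub>1, \<dots>, A\<^sub>\<delta>\<close> is a function on \<open>{1..\<delta>}\<close>, made extensional (hence \<open>undefined\<close> outside
  \<open>{1..\<delta>}\<close>) so that each tuple has exactly one representation.
\<close>

definition Z_verts :: "nat \<Rightarrow> nat \<Rightarrow> nat \<Rightarrow> (nat \<times> (nat \<Rightarrow> nat set)) set" where
  "Z_verts m R \<delta> = {(\<alpha>, A). A \<in> {1..\<delta>} \<rightarrow>\<^sub>E Pow {1..m}
     \<and> \<alpha> \<in> A 1
     \<and> (\<forall>i\<in>{1..<\<delta>}. A i \<subseteq> A (i + 1))
     \<and> (\<forall>i\<in>{1..<\<delta>}. card (A i) = 2 * i + 1)
     \<and> card (A \<delta>) = R}"

definition Z_adj :: "nat \<Rightarrow> nat \<times> (nat \<Rightarrow> nat set) \<Rightarrow> nat \<times> (nat \<Rightarrow> nat set) \<Rightarrow> bool" where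
  "Z_adj \<delta> = (\<lambda>(\<alpha>, A) (\<beta>, B). \<alpha> \<noteq> \<beta> \<and> \<alpha> \<in> B 1 \<and> \<beta> \<in> A 1
     \<and> (\<forall>i\<in>{1..<\<delta>}. A i \<subseteq> B (i + 1) \<and> B i \<subseteq> A (i + 1)))"

definition Z :: "nat \<Rightarrow> nat \<Rightarrow> nat \<Rightarrow> (nat \<times> (nat \<Rightarrow> nat set)) pair_pre_digraph" where
  "Z m R \<delta> = \<lparr> pverts = Z_verts m R \<delta>,
     parcs = {(u, v). u \<in> Z_verts m R \<delta> \<and> v \<in> Z_verts m R \<delta> \<and> Z_adj \<delta> u v} \<rparr>"

definition iterated_log2 :: "nat \<Rightarrow> real \<Rightarrow> real" where
  "iterated_log2 j x = (log 2 ^^ j) x"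

lemma chromatic_number_attained:
  assumes "pair_graph G"
  shows "\<exists>c. proper_coloring G (chromatic_number G) c"
proof -
  interpret pair_graph G by fact
  obtain f where f: "bij_betw f (pverts G) {0..<card (pverts G)}"
    using ex_bij_betw_finite_nat[OF pair_finite_verts] by blast
  have "proper_coloring G (card (pverts G)) (\<lambda>v. Suc (f v))"
    unfolding proper_coloring_def
  proof (intro conjI ballI)
    fix v assume "v \<in> pverts G"
    then have "f v \<in> {0..<card (pverts G)}" using f bij_betwE by blast
    then show "Suc (f v) \<in> {1..card (pverts G)}" by auto
  next
    fix e assume "e \<in> parcs G"
    moreover obtain u v where "e = (u, v)" by (cases e)
    ultimately show "case e of (u, v) \<Rightarrow> Suc (f u) \<noteq> Suc (f v)"
      using f pair_no_loops[of e] in_arcsD1[of u v] in_arcsD2[of u v]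
      by (auto simp: bij_betw_def inj_on_def)
  qed
  then have "\<exists>k c. proper_coloring G k c" by blast
  then show ?thesis
    unfolding chromatic_number_def by (rule LeastI_ex)
qed

lemma pair_graph_Z:
  assumes "\<delta> \<ge> 1"
  shows "pair_graph (Z m R \<delta>)"
proof -
  have "Z_verts m R \<delta> \<subseteq> {1..m} \<times> ({1..\<delta>} \<rightarrow>\<^sub>E Pow {1..m})"
  proof
    fix v assume v: "v \<in> Z_verts m R \<delta>"
    obtain \<alpha> A where v_eq: "v = (\<alpha>, A)" by (rule prod.exhaust)
    have A: "A \<in> {1..\<delta>} \<rightarrow>\<^sub>E Pow {1..m}" and \<alpha>: "\<alpha> \<in> A 1"
      using v unfolding v_eq Z_verts_def by blast+
    have "A 1 \<in> Pow {1..m}" by (rule PiE_mem[OF A]) (use assms in simp)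
    with \<alpha> have "\<alpha> \<in> {1..m}" by blast
    then show "v \<in> {1..m} \<times> ({1..\<delta>} \<rightarrow>\<^sub>E Pow {1..m})"
      unfolding v_eq using A by (rule SigmaI)
  qed
  moreover have "finite ({1..m} \<times> ({1..\<delta>} \<rightarrow>\<^sub>E Pow {1..m}))"
    by (intro finite_cartesian_product finite_PiE finite_atLeastAtMost) (simp only: finite_Pow_iff finite_atLeastAtMost)
  ultimately have fin: "finite (Z_verts m R \<delta>)"
    by (rule finite_subset)
  have verts: "pverts (Z m R \<delta>) = Z_verts m R \<delta>"
    by (simp add: Z_def)
  have arcs: "(u, v) \<in> parcs (Z m R \<delta>) \<longleftrightarrow>
      u \<in> Z_verts m R \<delta> \<and> v \<in> Z_verts m R \<delta> \<and> Z_adj \<delta> u v" for u v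
    by (simp add: Z_def)
  have "parcs (Z m R \<delta>) \<subseteq> Z_verts m R \<delta> \<times> Z_verts m R \<delta>"
    by (rule subrelI) (simp only: arcs mem_Sigma_iff simp_thms)
  then have fin_arcs: "finite (parcs (Z m R \<delta>))"
    by (rule finite_subset) (simp add: fin)
  have "Z_adj \<delta> v u" if "Z_adj \<delta> u v" for u v
    using that by (cases u; cases v) (simp add: Z_adj_def)
  then have "sym (parcs (Z m R \<delta>))"
    by (intro symI) (simp add: arcs)
  then have sym: "symmetric (with_proj (Z m R \<delta>))"
    by (simp add: symmetric_def)
  have irrefl: "\<not> Z_adj \<delta> u u" for u
    by (cases u) (simp add: Z_adj_def)
  show ?thesis
  proof
    fix e assume e: "e \<in> parcs (Z m R \<delta>)"
    obtain u v where e_eq: "e = (u, v)" by (rule prod.exhaust)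
    have uv: "u \<in> Z_verts m R \<delta> \<and> v \<in> Z_verts m R \<delta> \<and> Z_adj \<delta> u v"
      using e unfolding e_eq arcs .
    show "fst e \<in> pverts (Z m R \<delta>)" "snd e \<in> pverts (Z m R \<delta>)"
      using uv unfolding e_eq verts fst_conv snd_conv by blast+
    show "fst e \<noteq> snd e"
      using uv irrefl unfolding e_eq fst_conv snd_conv by metis
  qed (unfold verts, fact fin, fact fin_arcs, fact sym)
qed

end

theory Submission
  imports Defs "HOL-Real_Asymp.Real_Asymp"
begin

text \<open>
  Write \<open>R = 2\<delta> + 1 + t\<close> and let \<open>c\<close> be a proper colouring of \<open>Z(m,R,\<delta>)\<close> with \<open>K\<close> colours. An increasing
  tuple \<open>T\<close> of length \<open>2\<delta> - 1\<close> is a truncated chain \<open>\<alpha>, A\<^sub>1, \<dots>, A\<^bsub>\<delta>-1\<^esub>\<close> centred at its median, and only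
  \<open>A\<^sub>\<delta>\<close> remains to be chosen. If \<open>T'\<close> is a shift of \<open>T\<close>, then the colours of \<open>T\<close> with \<open>T' \<subseteq> A\<^sub>\<delta>\<close> are disjoint
  from the colours of \<open>T'\<close> with \<open>T \<subseteq> B\<^sub>\<delta>\<close>. So if both palettes lie in a common set \<open>Y\<close>, then requiring one more
  element in the last set halves one of them. Tuples whose palette cannot be halved are thus
  independent in the shift graph, and the others are split according to their new palette, at a
  cost of a factor \<open>2\<^sup>K\<close>. After \<open>t\<close> rounds the palettes have size at most \<open>K / 2\<^sup>t\<close>, and two free
  elements are left for the usual shift-graph argument, which colours the remaining tuples with
  \<open>2 ^ 2 ^ (K / 2\<^sup>t)\<close> colours. As the shift graph on \<open>(2\<delta> - 1)\<close>-tuples needs at least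
  \<open>log\<^bsup>(2\<delta>-2)\<^esup> m\<close> colours, \<open>K\<close> is at least about \<open>2\<^sup>t log\<^bsup>(2\<delta>)\<^esup> m\<close>; this exceeds the claimed
  bound by a constant factor, which absorbs all error terms, so \<open>\<epsilon> = 0\<close> works.
\<close>

section \<open>Colourings of digraphs\<close>

definition colourable :: "'v set \<Rightarrow> ('v \<times> 'v) set \<Rightarrow> nat \<Rightarrow> bool" where
  "colourable S E N \<longleftrightarrow> (\<exists>c :: 'v \<Rightarrow> nat. c ` S \<subseteq> {..<N} \<and>
     (\<forall>u\<in>S. \<forall>v\<in>S. (u, v) \<in> E \<longrightarrow> c u \<noteq> c v))"

text \<open>Colours may come from any finite set, so that options, palettes and families of palettes
  can serve as colours.\<close>

lemma colourableI:
  assumes "finite C" "card C \<le> N" "\<And>v. v \<in> S \<Longrightarrow> c v \<in> C"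
    and "\<And>u v. u \<in> S \<Longrightarrow> v \<in> S \<Longrightarrow> (u, v) \<in> E \<Longrightarrow> c u \<noteq> c v"
  shows "colourable S E N"
proof -
  obtain f where f: "bij_betw f C {0..<card C}"
    using ex_bij_betw_finite_nat[OF assms(1)] by blast
  have "f (c v) < N" if "v \<in> S" for v
    using bij_betwE[OF f] assms(2) assms(3)[OF that] by fastforce
  moreover have "f (c u) \<noteq> f (c v)" if "u \<in> S" "v \<in> S" "(u, v) \<in> E" for u v
    using assms(3,4) that bij_betw_imp_inj_on[OF f] by (metis inj_onD)
  ultimately show ?thesis
    unfolding colourable_def by (intro exI[of _ "f \<circ> c"]) auto
qed

lemma colourable_mono:
  assumes "colourable S E M" "M \<le> N"
  shows "colourable S E N"
proof -
  obtain c :: "'a \<Rightarrow> nat" where "c ` S \<subseteq> {..<M}" "\<forall>u\<in>S. \<forall>v\<in>S. (u, v) \<in> E \<longrightarrow> c u \<noteq> c v"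
    using assms(1) unfolding colourable_def by blast
  moreover have "{..<M} \<subseteq> {..<N}"
    using assms(2) by simp
  ultimately show ?thesis
    unfolding colourable_def by (intro exI[of _ c] conjI) (rule subset_trans)
qed

text \<open>A covered vertex takes as colour a chosen part containing it together with its colour in
  that part. The uncovered vertices are independent and share the one extra colour.\<close>

lemma colourable_union_step:
  fixes S :: "'y \<Rightarrow> 'v set"
  assumes "finite \<Y>" "card \<Y> \<le> p"
    and "\<And>Y. Y \<in> \<Y> \<Longrightarrow> colourable (S Y) E N"
    and "\<And>u v. u \<in> T - (\<Union>Y\<in>\<Y>. S Y) \<Longrightarrow> v \<in> T - (\<Union>Y\<in>\<Y>. S Y) \<Longrightarrow> (u, v) \<notin> E"
  shows "colourable T E (p * N + 1)"
proof -
  have "\<forall>Y\<in>\<Y>. \<exists>c :: 'v \<Rightarrow> nat. c ` S Y \<subseteq> {..<N} \<and>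
     (\<forall>u\<in>S Y. \<forall>v\<in>S Y. (u, v) \<in> E \<longrightarrow> c u \<noteq> c v)"
    using assms(3) unfolding colourable_def by blast
  then obtain c :: "'y \<Rightarrow> 'v \<Rightarrow> nat" where c: "\<And>Y. Y \<in> \<Y> \<Longrightarrow> c Y ` S Y \<subseteq> {..<N} \<and>
     (\<forall>u\<in>S Y. \<forall>v\<in>S Y. (u, v) \<in> E \<longrightarrow> c Y u \<noteq> c Y v)"
    by metis
  define y where "y v = (SOME Y. Y \<in> \<Y> \<and> v \<in> S Y)" for v
  have y: "y v \<in> \<Y> \<and> v \<in> S (y v)" if "v \<in> (\<Union>Y\<in>\<Y>. S Y)" for v
    unfolding y_def by (rule someI_ex) (use that in blast)
  define h where "h v = (if v \<in> (\<Union>Y\<in>\<Y>. S Y) then Some (y v, c (y v) v) else None)" for v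
  have fin: "finite (\<Y> \<times> {..<N})"
    using assms(1) by blast
  show ?thesis
  proof (rule colourableI)
    show "finite (insert None (Some ` (\<Y> \<times> {..<N})))"
      using fin by blast
    show "card (insert None (Some ` (\<Y> \<times> {..<N}))) \<le> p * N + 1"
      using fin assms(2) by (simp add: card_insert_if card_image card_cartesian_product)
    show "h v \<in> insert None (Some ` (\<Y> \<times> {..<N}))" for v
      using c y[of v] by (auto simp: h_def)
    show "h u \<noteq> h v" if "u \<in> T" "v \<in> T" "(u, v) \<in> E" for u v
    proof
      assume eq: "h u = h v"
      show False
      proof (cases "u \<in> (\<Union>Y\<in>\<Y>. S Y)")
        case True
        then have v: "v \<in> (\<Union>Y\<in>\<Y>. S Y)"
          using eq unfolding h_def by (metis option.distinct(1))
        have "Some (y u, c (y u) u) = Some (y v, c (y v) v)"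
          using eq unfolding h_def if_P[OF True] if_P[OF v] .
        then have eqs: "y v = y u" "c (y u) u = c (y u) v"
          by auto
        have "y u \<in> \<Y>" "u \<in> S (y u)" "v \<in> S (y u)"
          using y[OF True] y[OF v] eqs(1) by auto
        then show False
          using c[of "y u"] eqs(2) that(3) by blast
      next
        case False
        then have "v \<notin> (\<Union>Y\<in>\<Y>. S Y)"
          using eq unfolding h_def by (metis option.distinct(1))
        then show False
          using assms(4)[of u v] False that by blast
      qed
    qed
  qed
qed

section \<open>Shift graphs\<close>

definition increasing_lists :: "nat \<Rightarrow> nat \<Rightarrow> nat list set" where
  "increasing_lists m n = {xs. length xs = n \<and> sorted_wrt (<) xs \<and> set xs \<subseteq> {1..m}}"

text \<open>For \<open>n \<ge> 1\<close> an arc determines its longer list, so the arcs of one shift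
  graph are the vertices of the next, which is its line digraph.\<close>

definition shift_arcs :: "nat \<Rightarrow> nat \<Rightarrow> (nat list \<times> nat list) set" where
  "shift_arcs m n = (\<lambda>zs. (butlast zs, tl zs)) ` increasing_lists m (Suc n)"

lemma increasing_lists_butlast:
  assumes "zs \<in> increasing_lists m (Suc n)"
  shows "butlast zs \<in> increasing_lists m n"
  using assms in_set_butlastD[of _ zs] unfolding increasing_lists_def
  by (auto simp: butlast_conv_take sorted_wrt_take)

lemma increasing_lists_tl:
  assumes "zs \<in> increasing_lists m (Suc n)"
  shows "tl zs \<in> increasing_lists m n"
  using assms unfolding increasing_lists_def by (cases zs) auto

text \<open>Colouring each vertex by the set of colours on its outgoing arcs passes from a line
  digraph back to the original digraph at the cost of one exponential. On lists of length one,
  distinct vertices are always joined by an arc, so all colours differ.\<close>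

lemma shift_colourable_imp_le:
  assumes "colourable (increasing_lists m (Suc n)) (shift_arcs m (Suc n)) N"
  shows "m \<le> ((\<lambda>k. 2 ^ k) ^^ n) N"
  using assms
proof (induction n arbitrary: N)
  case 0
  then obtain c :: "nat list \<Rightarrow> nat" where c: "c ` increasing_lists m 1 \<subseteq> {..<N}"
    "\<And>u v. u \<in> increasing_lists m 1 \<Longrightarrow> v \<in> increasing_lists m 1 \<Longrightarrow>
      (u, v) \<in> shift_arcs m 1 \<Longrightarrow> c u \<noteq> c v"
    unfolding colourable_def by auto
  have v: "[a] \<in> increasing_lists m 1" if "a \<in> {1..m}" for a
    using that by (simp add: increasing_lists_def)
  have "c [a] \<noteq> c [b]" if "a \<in> {1..m}" "b \<in> {1..m}" "a < b" for a b
  proof (rule c(2))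
    have "[a, b] \<in> increasing_lists m (Suc 1)"
      using that by (simp add: increasing_lists_def)
    then show "([a], [b]) \<in> shift_arcs m 1"
      unfolding shift_arcs_def by (rule rev_image_eqI) simp
  qed (use v that in blast)+
  then have "inj_on (\<lambda>a. c [a]) {1..m}"
    by (intro linorder_inj_onI) auto
  moreover have "(\<lambda>a. c [a]) ` {1..m} \<subseteq> {..<N}"
    using c(1) v by blast
  ultimately have "card {1..m} \<le> card {..<N}"
    by (rule card_inj_on_le) simp
  then show ?case by simp
next
  case (Suc n)
  then obtain c :: "nat list \<Rightarrow> nat"
    where c: "c ` increasing_lists m (Suc (Suc n)) \<subseteq> {..<N}"
    "\<And>u v. u \<in> increasing_lists m (Suc (Suc n)) \<Longrightarrow> v \<in> increasing_lists m (Suc (Suc n)) \<Longrightarrow>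
      (u, v) \<in> shift_arcs m (Suc (Suc n)) \<Longrightarrow> c u \<noteq> c v"
    unfolding colourable_def by auto
  define h where "h xs = c ` {zs \<in> increasing_lists m (Suc (Suc n)). butlast zs = xs}" for xs
  have "colourable (increasing_lists m (Suc n)) (shift_arcs m (Suc n)) (2 ^ N)"
  proof (rule colourableI)
    show "finite (Pow {..<N})" "card (Pow {..<N}) \<le> 2 ^ N"
      by (simp_all add: card_Pow)
    show "h v \<in> Pow {..<N}" for v
      using c(1) unfolding h_def by blast
    fix xs ys assume "(xs, ys) \<in> shift_arcs m (Suc n)"
    then obtain zs where zs: "zs \<in> increasing_lists m (Suc (Suc n))" "xs = butlast zs" "ys = tl zs"
      unfolding shift_arcs_def by blast
    show "h xs \<noteq> h ys"
    proof
      \<comment> \<open>The colour of the arc \<open>zs\<close> from \<open>xs\<close> to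
        \<open>ys\<close> recurs on an arc \<open>ws\<close> leaving \<open>ys\<close>. But
        \<open>zs\<close> and \<open>ws\<close> are consecutive, hence joined in the longer shift
        graph by \<open>a # ws\<close>.\<close>
      assume "h xs = h ys"
      moreover have "c zs \<in> h xs"
        using zs unfolding h_def by blast
      ultimately obtain ws where ws: "ws \<in> increasing_lists m (Suc (Suc n))"
        "butlast ws = tl zs" "c zs = c ws"
        using zs unfolding h_def by blast
      obtain a zs' where zs_eq: "zs = a # zs'" and zs': "zs' \<noteq> []"
        using zs(1) unfolding increasing_lists_def by (cases zs) force+
      have tl_ne: "ws \<noteq> []"
        using ws(1) unfolding increasing_lists_def by auto
      have "a # ws \<in> increasing_lists m (Suc (Suc (Suc n)))"
      proof -
        have ws_eq: "ws = zs' @ [last ws]"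
          using ws(2) tl_ne append_butlast_last_id[of ws] zs_eq by simp
        have hd: "a < hd zs'" "hd zs' \<in> set zs'"
          using zs(1) zs' unfolding zs_eq increasing_lists_def by auto
        have "hd zs' < last ws"
        proof -
          have "sorted_wrt (<) (zs' @ [last ws])"
            using ws(1) unfolding ws_eq[symmetric] increasing_lists_def by simp
          then show ?thesis
            using hd(2) by (simp add: sorted_wrt_append)
        qed
        then have "\<forall>x\<in>set ws. a < x"
          using zs(1) hd(1) unfolding zs_eq increasing_lists_def by (subst ws_eq) auto
        then show ?thesis
          using ws(1) zs(1) unfolding zs_eq increasing_lists_def by auto
      qed
      then have "(zs, ws) \<in> shift_arcs m (Suc (Suc n))"
        unfolding shift_arcs_def
        by (rule rev_image_eqI) (use ws(2) tl_ne zs_eq in simp)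
      then show False
        using c(2) zs(1) ws(1,3) by blast
    qed
  qed
  then have "m \<le> ((\<lambda>k. 2 ^ k) ^^ n) (2 ^ N)"
    by (rule Suc.IH)
  then show ?case
    by (simp only: funpow_Suc_right comp_def)
qed

section \<open>The halving argument\<close>

text \<open>
  In the application \<open>F T X\<close> is the set of colours of the vertices of \<open>Z\<close> that extend the truncated
  chain \<open>T\<close> by a set containing \<open>X\<close>, and \<open>l\<close>, \<open>r\<close> are the first and last entries of a tuple.
\<close>

locale halving =
  fixes V :: "'v set" and E :: "('v \<times> 'v) set" and M :: "'a set"
    and F :: "'v \<Rightarrow> 'a set \<Rightarrow> nat set" and l r :: "'v \<Rightarrow> 'a" and K t :: nat
  assumes E: "E \<subseteq> V \<times> V"
    and F_colours: "T \<in> V \<Longrightarrow> F T X \<subseteq> {1..K}"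
    and F_antimono: "X \<subseteq> X' \<Longrightarrow> F T X' \<subseteq> F T X"
    and F_disjoint: "(T, T') \<in> E \<Longrightarrow> F T {r T'} \<inter> F T' {l T} = {}"
    and F_nonempty: "T \<in> V \<Longrightarrow> X \<subseteq> M \<Longrightarrow> finite X \<Longrightarrow> card X \<le> t + 2 \<Longrightarrow> F T X \<noteq> {}"
    and lr: "T \<in> V \<Longrightarrow> l T \<in> M" "T \<in> V \<Longrightarrow> r T \<in> M"
begin

text \<open>\<open>X\<close> holds the elements already forced into the last set, one per halving
  round. Of the \<open>t + 2\<close> elements that \<open>F_nonempty\<close> allows,
  \<open>t\<close> are spent on the rounds and two in the base case.\<close>

definition confined :: "nat \<Rightarrow> nat set \<Rightarrow> 'v set" where
  "confined j Y = {T \<in> V. \<exists>X\<subseteq>M. finite X \<and> card X \<le> j \<and> F T X \<subseteq> Y}"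

text \<open>
  Two steps of the usual shift-graph argument: first forget the last entry, then the first one.
  The second step goes in the opposite direction so that both stay inside the palette \<open>Y\<close>
  belonging to the middle tuple.
\<close>

lemma colourable_confined_base:
  assumes "finite Y"
  shows "colourable (confined t Y) E (2 ^ 2 ^ card Y)"
proof -
  have "\<forall>T\<in>confined t Y. \<exists>X. X \<subseteq> M \<and> finite X \<and> card X \<le> t \<and> F T X \<subseteq> Y"
    unfolding confined_def by blast
  then obtain x where x: "\<And>T. T \<in> confined t Y \<Longrightarrow>
      x T \<subseteq> M \<and> finite (x T) \<and> card (x T) \<le> t \<and> F T (x T) \<subseteq> Y"
    by metis
  \<comment> \<open>On a path \<open>U\<close>, \<open>T\<close>, \<open>W\<close> both outer ends
    are forced in. Taking the union over \<open>W\<close> and then the family over \<open>U\<close>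
    leaves a colour that depends on \<open>T\<close> alone.\<close>
  define g where "g U T = (\<Union>W\<in>E `` {T}. F T (x T \<union> {l U, r W}))" for U T
  define h where "h T = (\<lambda>U. g U T) ` (E\<inverse> `` {T})" for T
  show ?thesis
  proof (rule colourableI)
    show "finite (Pow (Pow Y))" "card (Pow (Pow Y)) \<le> 2 ^ 2 ^ card Y"
      using assms by (simp_all add: card_Pow)
    show "h T \<in> Pow (Pow Y)" if "T \<in> confined t Y" for T
    proof -
      have "F T (x T \<union> Q) \<subseteq> Y" for Q
        using F_antimono[of "x T" "x T \<union> Q" T] x[OF that] by blast
      then show ?thesis
        unfolding h_def g_def by blast
    qed
    fix T T' assume T: "T \<in> confined t Y" "T' \<in> confined t Y" and arc: "(T, T') \<in> E"
    show "h T \<noteq> h T'"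
    proof
      assume eq: "h T = h T'"
      \<comment> \<open>\<open>T\<close> is a predecessor of \<open>T'\<close>, so equal families
        yield a predecessor \<open>U\<close> of \<open>T\<close> with
        \<open>g T T' = g U T\<close>.\<close>
      have "g T T' \<in> h T'"
        using arc unfolding h_def by blast
      then have "g T T' \<in> (\<lambda>U. g U T) ` (E\<inverse> `` {T})"
        unfolding eq[symmetric] by (simp only: h_def)
      then obtain U where U: "(U, T) \<in> E" "g T T' = g U T"
        by blast
      have V: "U \<in> V" "T \<in> V" "T' \<in> V"
        using U(1) arc E by auto
      have xT: "x T \<subseteq> M" "finite (x T)" "card (x T) \<le> t"
        using x[OF T(1)] by auto
      \<comment> \<open>The two spare elements are \<open>l U\<close> and \<open>r T'\<close>. A
        surviving colour \<open>q\<close> lies in \<open>g U T = g T T'\<close>, hence in both of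
        the sets that \<open>F_disjoint\<close> separates.\<close>
      have "card (x T \<union> {l U, r T'}) \<le> card (x T) + card {l U, r T'}"
        by (rule card_Un_le)
      also have "\<dots> \<le> t + 2"
        using xT(3) by (intro add_mono) (auto simp: card_insert_if)
      finally have "F T (x T \<union> {l U, r T'}) \<noteq> {}"
        using xT lr V by (intro F_nonempty) auto
      then obtain q where q: "q \<in> F T (x T \<union> {l U, r T'})"
        by blast
      then have q1: "q \<in> F T {r T'}"
        using F_antimono[of "{r T'}" "x T \<union> {l U, r T'}" T] by blast
      have "q \<in> g T T'"
        unfolding U(2) unfolding g_def by (rule UN_I[of T']) (use q arc in auto)
      then obtain W where "q \<in> F T' (x T' \<union> {l T, r W})"
        unfolding g_def by blast
      then have "q \<in> F T' {l T}"
        using F_antimono[of "{l T}" "x T' \<union> {l T, r W}" T'] by blast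
      then show False
        using q1 F_disjoint[OF arc] by blast
    qed
  qed
qed

text \<open>
  Along an arc inside \<open>confined j Y\<close>, adding one element at each end yields disjoint subsets of \<open>Y\<close>,
  one of which has at most half its size. Hence the tuples whose palette cannot be halved are
  independent.
\<close>

lemma colourable_confined:
  assumes "j + d = t" "Y \<subseteq> {1..K}" "card Y * 2 ^ j \<le> K"
  shows "colourable (confined j Y) E (2 ^ (d * (K + 1)) * 2 ^ 2 ^ (K div 2 ^ t))"
  using assms
proof (induction d arbitrary: j Y)
  case 0
  have "card Y \<le> K div 2 ^ t"
    using 0 by (simp add: less_eq_div_iff_mult_less_eq)
  moreover have "finite Y"
    using 0 finite_subset by blast
  ultimately show ?case
    using colourable_confined_base[of Y] 0 by (auto intro: colourable_mono)
next
  case (Suc d)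
  define \<Y> where "\<Y> = {Y'. Y' \<subseteq> {1..K} \<and> card Y' * 2 ^ Suc j \<le> K}"
  define N :: nat where "N = 2 ^ (d * (K + 1)) * 2 ^ 2 ^ (K div 2 ^ t)"
  have sub: "\<Y> \<subseteq> Pow {1..K}"
    unfolding \<Y>_def by blast
  have "colourable (confined j Y) E (2 ^ K * N + 1)"
  proof (rule colourable_union_step)
    show "finite \<Y>"
      using sub by (rule finite_subset) simp
    show "card \<Y> \<le> 2 ^ K"
      using card_mono[OF _ sub] by (simp add: card_Pow)
    show "colourable (confined (Suc j) Y') E N" if "Y' \<in> \<Y>" for Y'
      unfolding N_def using that Suc by (intro Suc.IH) (auto simp: \<Y>_def)
    fix T T'
    assume T: "T \<in> confined j Y - (\<Union>Y'\<in>\<Y>. confined (Suc j) Y')"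
      and T': "T' \<in> confined j Y - (\<Union>Y'\<in>\<Y>. confined (Suc j) Y')"
    show "(T, T') \<notin> E"
    proof
      assume arc: "(T, T') \<in> E"
      have V: "T \<in> V" "T' \<in> V"
        using arc E by auto
      \<comment> \<open>Otherwise forcing \<open>e\<close> in would place \<open>S\<close> in one of
        the classes of the next round.\<close>
      have large: "K < card (F S (insert e X)) * 2 ^ Suc j"
        if S: "S \<in> V" "S \<notin> (\<Union>Y'\<in>\<Y>. confined (Suc j) Y')"
          and X: "X \<subseteq> M" "finite X" "card X \<le> j" "e \<in> M" for S e X
      proof (rule ccontr)
        assume "\<not> ?thesis"
        then have "F S (insert e X) \<in> \<Y>"
          using F_colours[OF S(1)] by (simp add: \<Y>_def)
        moreover have "S \<in> confined (Suc j) (F S (insert e X))"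
          unfolding confined_def using S(1) X
          by (auto intro!: exI[of _ "insert e X"] simp: card_insert_if)
        ultimately show False
          using S(2) by blast
      qed
      obtain X where X: "X \<subseteq> M" "finite X" "card X \<le> j" "F T X \<subseteq> Y"
        using T unfolding confined_def by blast
      obtain X' where X': "X' \<subseteq> M" "finite X'" "card X' \<le> j" "F T' X' \<subseteq> Y"
        using T' unfolding confined_def by blast
      let ?P = "F T (insert (r T') X)" and ?Q = "F T' (insert (l T) X')"
      have PQ: "?P \<subseteq> Y" "?Q \<subseteq> Y" "?P \<inter> ?Q = {}"
        using F_antimono[of X "insert (r T') X" T] F_antimono[of X' "insert (l T) X'" T']
          F_antimono[of "{r T'}" "insert (r T') X" T] F_antimono[of "{l T}" "insert (l T) X'" T']
          X(4) X'(4) F_disjoint[OF arc] by blast+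
      have fin: "finite Y"
        using Suc.prems finite_subset by blast
      have "card ?P + card ?Q = card (?P \<union> ?Q)"
        using PQ fin by (intro card_Un_disjoint[symmetric]) (auto intro: finite_subset)
      also have "\<dots> \<le> card Y"
        using PQ fin by (intro card_mono) auto
      finally have "(card ?P + card ?Q) * 2 ^ j \<le> K"
        using Suc.prems(3) by (meson le_trans mult_le_mono1)
      moreover have "K < card ?P * 2 ^ Suc j"
        using X T V lr by (intro large) auto
      moreover have "K < card ?Q * 2 ^ Suc j"
        using X' T' V lr by (intro large) auto
      ultimately show False
        by (simp add: algebra_simps)
    qed
  qed
  \<comment> \<open>The extra colour costs at most a doubling, whence \<open>K + 1\<close> instead
    of \<open>K\<close> in the exponent of each round.\<close>
  moreover have "2 ^ K * N + 1 \<le> 2 ^ (K + 1) * N"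
  proof -
    have "1 \<le> 2 ^ K * N"
      by (simp add: N_def)
    then show ?thesis by simp
  qed
  moreover have "2 ^ (K + 1) * N = 2 ^ (Suc d * (K + 1)) * 2 ^ 2 ^ (K div 2 ^ t)"
    by (simp add: N_def power_add)
  ultimately show ?case
    using colourable_mono by metis
qed

text \<open>The rounds start with no forced element and the full palette. A single power of two is
  kept so that it can become one more level of the tower.\<close>

lemma colourable_V: "colourable V E (2 ^ (t * (K + 1) + 2 ^ (K div 2 ^ t)))"
proof -
  have "V = confined 0 {1..K}"
    unfolding confined_def using F_colours[of _ "{}"] by (auto intro!: exI[of _ "{}"])
  then show ?thesis
    using colourable_confined[of 0 t "{1..K}"] by (simp add: power_add)
qed

end

section \<open>Shift graphs inside \<open>Z\<close>\<close>

text \<open>Positions count from 0, so \<open>\<delta> - 1\<close> is the median of a list of length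
  \<open>2 * \<delta> - 1\<close>, and the window for \<open>i = \<delta> - 1\<close> is the whole
  list.\<close>

definition centred_vertex :: "nat \<Rightarrow> nat list \<Rightarrow> nat set \<Rightarrow> nat \<times> (nat \<Rightarrow> nat set)" where
  "centred_vertex \<delta> xs A = (xs ! (\<delta> - 1),
     \<lambda>i\<in>{1..\<delta>}. if i = \<delta> then A else (!) xs ` {\<delta> - 1 - i..\<delta> - 1 + i})"

lemma centred_vertex_in_Z:
  assumes \<delta>: "\<delta> \<ge> 1" and xs: "xs \<in> increasing_lists m (2 * \<delta> - 1)"
    and A: "set xs \<subseteq> A" "A \<subseteq> {1..m}" "card A = R"
  shows "centred_vertex \<delta> xs A \<in> Z_verts m R \<delta>"
proof -
  have len: "length xs = 2 * \<delta> - 1" and sub: "set xs \<subseteq> {1..m}" and dist: "distinct xs"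
    using xs unfolding increasing_lists_def by (auto simp: strict_sorted_iff)
  define B where "B i = (!) xs ` {\<delta> - 1 - i..\<delta> - 1 + i}" for i
  have B: "B i \<subseteq> set xs" if "i < \<delta>" for i
    using that len unfolding B_def by auto
  have "card (B i) = 2 * i + 1" if "i < \<delta>" for i
  proof -
    have "inj_on ((!) xs) {\<delta> - 1 - i..\<delta> - 1 + i}"
      using that len dist by (auto intro!: inj_on_nth)
    then show ?thesis
      unfolding B_def using that by (simp add: card_image)
  qed
  moreover have "B i \<subseteq> B (i + 1)" for i
    unfolding B_def by (intro image_mono) auto
  moreover have "xs ! (\<delta> - 1) \<in> B 1" "xs ! (\<delta> - 1) \<in> A"
    using A(1) len \<delta> unfolding B_def by (auto intro!: imageI)
  moreover have "B i \<subseteq> A" "B i \<subseteq> {1..m}" if "i < \<delta>" for i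
    using B[OF that] A sub by auto
  ultimately show ?thesis
    unfolding Z_verts_def centred_vertex_def B_def[symmetric] using \<delta> A
    by (auto simp: less_Suc_eq_le le_less)
qed

text \<open>Read inside \<open>zs\<close>, the windows of \<open>tl zs\<close> are those of
  \<open>butlast zs\<close> moved one place to the right, so each fits into the next larger window
  of the other list. At the top level \<open>A\<close> and \<open>B\<close> contain all of
  \<open>zs\<close>.\<close>

lemma centred_vertex_adj:
  assumes \<delta>: "\<delta> \<ge> 1" and zs: "zs \<in> increasing_lists m (2 * \<delta>)"
    and A: "set zs \<subseteq> A" and B: "set zs \<subseteq> B"
  shows "Z_adj \<delta> (centred_vertex \<delta> (butlast zs) A) (centred_vertex \<delta> (tl zs) B)"
proof -
  have len: "length zs = 2 * \<delta>" and dist: "distinct zs"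
    using zs unfolding increasing_lists_def by (auto simp: strict_sorted_iff)
  have nth: "butlast zs ! k = zs ! k" "tl zs ! k = zs ! Suc k" if "k < 2 * \<delta> - 1" for k
    using that len by (auto simp: nth_butlast nth_tl)
  have mem: "zs ! k \<in> set zs" if "k < 2 * \<delta>" for k
    using that len by simp
  have bl: "(!) (butlast zs) ` {\<delta> - 1 - i..\<delta> - 1 + i} = (!) zs ` {\<delta> - 1 - i..\<delta> - 1 + i}"
    if "i < \<delta>" for i
    using that by (intro image_cong) (auto simp: nth)
  have tl: "(!) (tl zs) ` {\<delta> - 1 - i..\<delta> - 1 + i} = (!) zs ` {\<delta> - i..\<delta> + i}"
    if "i < \<delta>" for i
  proof -
    have "(!) (tl zs) ` {\<delta> - 1 - i..\<delta> - 1 + i} = (\<lambda>k. zs ! Suc k) ` {\<delta> - 1 - i..\<delta> - 1 + i}"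
      using that by (intro image_cong) (auto simp: nth)
    also have "\<dots> = (!) zs ` Suc ` {\<delta> - 1 - i..\<delta> - 1 + i}"
      by (simp only: image_image)
    also have "Suc ` {\<delta> - 1 - i..\<delta> - 1 + i} = {\<delta> - i..\<delta> + i}"
      using that \<delta> by (simp add: image_Suc_atLeastAtMost Suc_diff_Suc)
    finally show ?thesis .
  qed
  define P where "P = snd (centred_vertex \<delta> (butlast zs) A)"
  define Q where "Q = snd (centred_vertex \<delta> (tl zs) B)"
  have P: "P i = (if i = \<delta> then A else (!) zs ` {\<delta> - 1 - i..\<delta> - 1 + i})"
    and Q: "Q i = (if i = \<delta> then B else (!) zs ` {\<delta> - i..\<delta> + i})" if "i \<in> {1..\<delta>}" for i
  proof -
    have "P i = (if i = \<delta> then A else (!) (butlast zs) ` {\<delta> - 1 - i..\<delta> - 1 + i})"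
      "Q i = (if i = \<delta> then B else (!) (tl zs) ` {\<delta> - 1 - i..\<delta> - 1 + i})"
      using that by (simp_all add: P_def Q_def centred_vertex_def)
    moreover have "i = \<delta> \<or> i \<noteq> \<delta> \<and> i < \<delta>"
      using that by auto
    ultimately show "P i = (if i = \<delta> then A else (!) zs ` {\<delta> - 1 - i..\<delta> - 1 + i})"
      "Q i = (if i = \<delta> then B else (!) zs ` {\<delta> - i..\<delta> + i})"
      by (elim disjE conjE; simp only: bl tl if_True if_False)+
  qed
  have v: "centred_vertex \<delta> (butlast zs) A = (zs ! (\<delta> - 1), P)"
    "centred_vertex \<delta> (tl zs) B = (zs ! \<delta>, Q)"
    using \<delta> nth[of "\<delta> - 1"] by (auto simp: P_def Q_def centred_vertex_def)
  have "zs ! (\<delta> - 1) \<noteq> zs ! \<delta>"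
    using dist len \<delta> by (auto simp: nth_eq_iff_index_eq)
  moreover have "zs ! (\<delta> - 1) \<in> Q 1" "zs ! \<delta> \<in> P 1"
    using P[of 1] Q[of 1] A B mem \<delta> by (auto intro!: imageI)
  moreover have "P i \<subseteq> Q (i + 1)" "Q i \<subseteq> P (i + 1)" if "i \<in> {1..<\<delta>}" for i
  proof -
    let ?I = "{\<delta> - 1 - i..\<delta> - 1 + i}" and ?J = "{\<delta> - i..\<delta> + i}"
    let ?I' = "{\<delta> - 1 - (i + 1)..\<delta> - 1 + (i + 1)}" and ?J' = "{\<delta> - (i + 1)..\<delta> + (i + 1)}"
    have "(!) zs ` ?I \<subseteq> set zs" "(!) zs ` ?J \<subseteq> set zs"
      using that mem by auto
    then have sub: "(!) zs ` ?I \<subseteq> B" "(!) zs ` ?J \<subseteq> A"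
      using A B by blast+
    have mono: "(!) zs ` ?I \<subseteq> (!) zs ` ?J'" "(!) zs ` ?J \<subseteq> (!) zs ` ?I'"
      using \<delta> by (intro image_mono; auto)+
    have i: "i \<in> {1..\<delta>}" "i \<noteq> \<delta>" "i + 1 \<in> {1..\<delta>}"
      using that by auto
    show "P i \<subseteq> Q (i + 1)" "Q i \<subseteq> P (i + 1)"
      unfolding P[OF i(1)] Q[OF i(1)] P[OF i(3)] Q[OF i(3)] if_not_P[OF i(2)]
      using sub mono by (cases "i + 1 = \<delta>"; simp only: if_True if_False)+
  qed
  ultimately show ?thesis
    unfolding v Z_adj_def by simp
qed

lemma proper_coloring_Z_imp_le:
  assumes \<delta>: "\<delta> \<ge> 1" and R: "R = 2 * \<delta> + 1 + t" and m: "R \<le> m"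
    and c: "proper_coloring (Z m R \<delta>) K c"
  shows "m \<le> ((\<lambda>k. 2 ^ k) ^^ (2 * \<delta> - 2)) (2 ^ (t * (K + 1) + 2 ^ (K div 2 ^ t)))"
proof -
  define n where "n = 2 * \<delta> - 1"
  have n: "Suc n = 2 * \<delta>" "n = Suc (2 * \<delta> - 2)"
    using \<delta> by (auto simp: n_def)
  define F where "F xs X = (\<lambda>A. c (centred_vertex \<delta> xs A)) `
      {A. set xs \<union> X \<subseteq> A \<and> A \<subseteq> {1..m} \<and> card A = R}" for xs X
  have colours: "c v \<in> {1..K}" if "v \<in> Z_verts m R \<delta>" for v
    using c that by (auto simp: proper_coloring_def Z_def)
  have proper: "c u \<noteq> c v" if "u \<in> Z_verts m R \<delta>" "v \<in> Z_verts m R \<delta>" "Z_adj \<delta> u v" for u v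
  proof -
    have "(u, v) \<in> parcs (Z m R \<delta>)"
      using that by (simp add: Z_def)
    moreover have "\<forall>(u, v)\<in>parcs (Z m R \<delta>). c u \<noteq> c v"
      using c unfolding proper_coloring_def by simp
    ultimately show ?thesis
      by blast
  qed
  interpret halving "increasing_lists m n" "shift_arcs m n" "{1..m}" F hd last K t
  proof
    show "shift_arcs m n \<subseteq> increasing_lists m n \<times> increasing_lists m n"
      unfolding shift_arcs_def using increasing_lists_butlast increasing_lists_tl by blast
    show "F xs X \<subseteq> {1..K}" if "xs \<in> increasing_lists m n" for xs X
      using that colours centred_vertex_in_Z[OF \<delta>] unfolding F_def n_def by blast
    show "F xs X' \<subseteq> F xs X" if "X \<subseteq> X'" for xs X X'
      unfolding F_def using that by (intro image_mono) auto
    show "F xs {last ys} \<inter> F ys {hd xs} = {}" if arc: "(xs, ys) \<in> shift_arcs m n" for xs ys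
    proof -
      obtain zs where zs: "zs \<in> increasing_lists m (2 * \<delta>)"
        and xy: "xs = butlast zs" "ys = tl zs"
        using arc unfolding shift_arcs_def n(1) by blast
      have xs_in: "xs \<in> increasing_lists m (2 * \<delta> - 1)" and ys_in: "ys \<in> increasing_lists m (2 * \<delta> - 1)"
        using zs increasing_lists_butlast[of zs m n] increasing_lists_tl[of zs m n] n xy
        by (auto simp: n_def)
      have ne: "zs \<noteq> []" "xs \<noteq> []" "ys \<noteq> []"
        using zs xs_in ys_in \<delta> unfolding increasing_lists_def by auto
      \<comment> \<open>Forcing just the one missing entry into each last set makes both contain all
        of \<open>zs\<close>, as adjacency requires.\<close>
      have set1: "set zs = insert (last ys) (set xs)"
        using ne xy by (metis append_butlast_last_id last_tl list.set_intros(1) list.simps(15)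
            rotate1.simps(2) set_rotate1)
      have set2: "set zs = insert (hd xs) (set ys)"
        using ne xy by (metis append_butlast_last_id hd_append2 list.exhaust_sel list.simps(15))
      have "c (centred_vertex \<delta> xs A) \<noteq> c (centred_vertex \<delta> ys B)"
        if "set xs \<union> {last ys} \<subseteq> A" "A \<subseteq> {1..m}" "card A = R"
          "set ys \<union> {hd xs} \<subseteq> B" "B \<subseteq> {1..m}" "card B = R" for A B
      proof (rule proper)
        show "Z_adj \<delta> (centred_vertex \<delta> xs A) (centred_vertex \<delta> ys B)"
          unfolding xy
        proof (rule centred_vertex_adj[OF \<delta> zs])
          show "set zs \<subseteq> A"
            unfolding set1 using that(1) by simp
          show "set zs \<subseteq> B"
            unfolding set2 using that(4) by simp
        qed
      qed (use that xs_in ys_in in \<open>auto intro!: centred_vertex_in_Z[OF \<delta>]\<close>)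
      then show ?thesis
        unfolding F_def by blast
    qed
    show "F xs X \<noteq> {}"
      if xs: "xs \<in> increasing_lists m n" and X: "X \<subseteq> {1..m}" "finite X" "card X \<le> t + 2" for xs X
    proof -
      have "card (set xs \<union> X) \<le> card (set xs) + card X"
        by (rule card_Un_le)
      \<comment> \<open>Here the budget is exact:
        \<open>(2 * \<delta> - 1) + (t + 2) = R\<close>.\<close>
      also have "\<dots> \<le> R"
        using xs X(3) R card_length[of xs] n(1) unfolding increasing_lists_def by auto
      finally have le: "card (set xs \<union> X) \<le> R" .
      have sub: "set xs \<union> X \<subseteq> {1..m}"
        using xs X unfolding increasing_lists_def by auto
      obtain A where "set xs \<union> X \<subseteq> A" "A \<subseteq> {1..m}" "card A = R"
        using exists_subset_between[OF le _ sub] m by auto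
      then show ?thesis
        unfolding F_def by blast
    qed
    show "hd xs \<in> {1..m}" "last xs \<in> {1..m}" if "xs \<in> increasing_lists m n" for xs
    proof -
      have "xs \<noteq> []" "set xs \<subseteq> {1..m}"
        using that n(2) unfolding increasing_lists_def by auto
      then show "hd xs \<in> {1..m}" "last xs \<in> {1..m}"
        using hd_in_set last_in_set by blast+
    qed
  qed
  show ?thesis
    using shift_colourable_imp_le[of m "2 * \<delta> - 2"] colourable_V n(2) by simp
qed

section \<open>Iterated logarithms\<close>

lemma iterated_log2_Suc: "iterated_log2 (Suc j) x = log 2 (iterated_log2 j x)"
  by (simp add: iterated_log2_def)

lemma filterlim_iterated_log2: "filterlim (iterated_log2 j) at_top at_top"
proof (induction j)
  case 0
  then show ?case by (simp add: iterated_log2_def[abs_def] filterlim_ident)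
next
  case (Suc j)
  have "filterlim (log 2) at_top at_top"
    by real_asymp
  then show ?case
    unfolding iterated_log2_Suc[abs_def] using Suc by (rule filterlim_compose)
qed

text \<open>Each logarithm removes one level of the tower. The earlier iterates must be positive for
  the logarithm to be monotone there.\<close>

lemma iterated_log2_le_tower:
  assumes "\<And>i. i < j \<Longrightarrow> iterated_log2 i x > 0" "x \<le> real (((\<lambda>k. 2 ^ k) ^^ j) N)"
  shows "iterated_log2 j x \<le> real N"
  using assms
proof (induction j arbitrary: N)
  case 0
  then show ?case by (simp add: iterated_log2_def)
next
  case (Suc j)
  have "iterated_log2 j x \<le> real (2 ^ N)"
    using Suc.prems by (intro Suc.IH) (simp_all only: funpow_Suc_right comp_def less_Suc_eq simp_thms)
  then show ?case
    using Suc.prems(1)[of j] by (simp add: iterated_log2_Suc log_le_iff powr_realpow)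
qed

theorem theorem4p7:
  fixes R \<delta> :: nat
  assumes "R \<ge> 1" and "\<delta> \<ge> 1" and "R \<ge> 2 * \<delta> + 1"
  shows "\<exists>\<epsilon> :: nat \<Rightarrow> real. \<epsilon> \<longlonglongrightarrow> 0 \<and>
    (\<forall>\<^sub>F m in sequentially.
      real (chromatic_number (Z m R \<delta>))
        > 2 powr ((real R - 2 * real \<delta> - 4) / 2) * iterated_log2 (2 * \<delta>) (real m) + \<epsilon> m)"
proof -
  obtain t where R: "R = 2 * \<delta> + 1 + t"
    using assms(3) le_Suc_ex by blast
  obtain j where j: "2 * \<delta> - 2 = j" "2 * \<delta> = Suc (Suc j)"
    using assms(2) by (cases \<delta>) auto
  define a where "a = 2 powr ((real R - 2 * real \<delta> - 4) / 2)"
  have a: "a = 2 powr ((real t - 3) / 2)"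
    by (simp add: a_def R)
  \<comment> \<open>The exponent is \<open>-(t + 3) / 2\<close>, at most -1. This slack later bounds
    the doubly exponential error term by a square root.\<close>
  have a_half: "a / 2 ^ t \<le> 1 / 2"
  proof -
    have "a / 2 ^ t = 2 powr ((real t - 3) / 2 - real t)"
      by (simp add: a powr_diff powr_realpow)
    also have "(real t - 3) / 2 - real t = - (real t + 3) / 2"
      by (simp add: field_simps)
    also have "2 powr (- (real t + 3) / 2) \<le> 2 powr (-1 :: real)"
      by (intro powr_mono) (simp_all add: field_simps)
    finally show ?thesis
      by (simp add: powr_minus_divide)
  qed
  \<comment> \<open>Here \<open>y\<close> will be the logarithm iterated
    \<open>2 * \<delta> - 1\<close> times, and the left side bounds the number of colours, up to one
    logarithm, when \<open>K \<le> a * log 2 y\<close>.\<close>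
  have "\<forall>\<^sub>F y :: real in at_top. real t * (a * log 2 y + 1) + sqrt y < y"
  proof -
    have "((\<lambda>y :: real. log 2 y / y) \<longlongrightarrow> 0) at_top" "((\<lambda>y :: real. 1 / y) \<longlongrightarrow> 0) at_top"
      "((\<lambda>y :: real. sqrt y / y) \<longlongrightarrow> 0) at_top"
      by real_asymp+
    then have "((\<lambda>y :: real. real t * (a * (log 2 y / y) + 1 / y) + sqrt y / y)
        \<longlongrightarrow> real t * (a * 0 + 0) + 0) at_top"
      by (intro tendsto_intros)
    then have "\<forall>\<^sub>F y :: real in at_top. real t * (a * (log 2 y / y) + 1 / y) + sqrt y / y < 1"
      by (rule order_tendstoD) simp
    then show ?thesis
      using eventually_gt_at_top[of 0] by eventually_elim (simp add: field_simps)
  qed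
  then have "\<forall>\<^sub>F y :: real in at_top. real t * (a * log 2 y + 1) + sqrt y < y \<and> 1 < y"
    using eventually_gt_at_top[of 1] by (rule eventually_conj)
  then have "\<forall>\<^sub>F x in at_top. real t * (a * log 2 (iterated_log2 (Suc j) x) + 1)
      + sqrt (iterated_log2 (Suc j) x) < iterated_log2 (Suc j) x \<and> 1 < iterated_log2 (Suc j) x"
    by (rule eventually_compose_filterlim[OF _ filterlim_iterated_log2])
  moreover have "\<forall>\<^sub>F x in at_top. \<forall>i\<in>{..j}. iterated_log2 i x > 0"
    by (intro eventually_ball_finite ballI eventually_compose_filterlim[OF eventually_gt_at_top
        filterlim_iterated_log2] finite_atMost)
  ultimately have "\<forall>\<^sub>F x in at_top. (real t * (a * log 2 (iterated_log2 (Suc j) x) + 1)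
      + sqrt (iterated_log2 (Suc j) x) < iterated_log2 (Suc j) x \<and> 1 < iterated_log2 (Suc j) x)
      \<and> (\<forall>i\<in>{..j}. iterated_log2 i x > 0)"
    by (rule eventually_conj)
  then have ev: "\<forall>\<^sub>F m in sequentially. (real t * (a * log 2 (iterated_log2 (Suc j) (real m)) + 1)
      + sqrt (iterated_log2 (Suc j) (real m)) < iterated_log2 (Suc j) (real m)
      \<and> 1 < iterated_log2 (Suc j) (real m)) \<and> (\<forall>i\<in>{..j}. iterated_log2 i (real m) > 0)"
    by (rule eventually_compose_filterlim[OF _ filterlim_real_sequentially])
  have "\<forall>\<^sub>F m in sequentially.
      real (chromatic_number (Z m R \<delta>)) > a * iterated_log2 (2 * \<delta>) (real m) + 0"
    using ev eventually_ge_at_top[of R]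
  proof eventually_elim
    case (elim m)
    define K where "K = chromatic_number (Z m R \<delta>)"
    define y where "y = iterated_log2 (Suc j) (real m)"
    have y: "real t * (a * log 2 y + 1) + sqrt y < y" "1 < y"
      using elim(1) unfolding y_def by auto
    obtain c where "proper_coloring (Z m R \<delta>) K c"
      unfolding K_def using chromatic_number_attained[OF pair_graph_Z[OF assms(2)]] by blast
    then have "m \<le> ((\<lambda>k. 2 ^ k) ^^ j) (2 ^ (t * (K + 1) + 2 ^ (K div 2 ^ t)))"
      using proper_coloring_Z_imp_le[OF assms(2) R elim(2)] j(1) by simp
    then have "m \<le> ((\<lambda>k. 2 ^ k) ^^ Suc j) (t * (K + 1) + 2 ^ (K div 2 ^ t))"
      by (simp only: funpow_Suc_right comp_def)
    then have "y \<le> real (t * (K + 1) + 2 ^ (K div 2 ^ t))"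
      unfolding y_def using elim(1) by (intro iterated_log2_le_tower) auto
    also have "\<dots> = real t * (real K + 1) + 2 powr real (K div 2 ^ t)"
      by (simp add: powr_realpow distrib_left)
    also have "\<dots> \<le> real t * (real K + 1) + 2 powr (real K / 2 ^ t)"
      using of_nat_div_le_of_nat[of K "2 ^ t", where 'a = real] by (intro add_left_mono powr_mono) auto
    finally have up: "y \<le> real t * (real K + 1) + 2 powr (real K / 2 ^ t)" .
    \<comment> \<open>If not, the two terms of \<open>up\<close> are at most
      \<open>t * (a * log 2 y + 1)\<close> and \<open>sqrt y\<close>, whose sum is below
      \<open>y\<close>.\<close>
    have "a * log 2 y < real K"
    proof (rule ccontr)
      assume "\<not> ?thesis"
      then have K: "real K \<le> a * log 2 y" by simp
      then have "real K / 2 ^ t \<le> (a / 2 ^ t) * log 2 y"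
        by (simp add: divide_simps)
      also have "\<dots> \<le> 1 / 2 * log 2 y"
        using a_half y(2) by (intro mult_right_mono) auto
      finally have "2 powr (real K / 2 ^ t) \<le> 2 powr (1 / 2 * log 2 y)"
        by (intro powr_mono) auto
      also have "\<dots> = (2 powr log 2 y) powr (1 / 2)"
        by (simp add: powr_powr mult.commute)
      also have "\<dots> = sqrt y"
        using y(2) by (simp add: powr_half_sqrt)
      finally have "2 powr (real K / 2 ^ t) \<le> sqrt y" .
      moreover have "real t * (real K + 1) \<le> real t * (a * log 2 y + 1)"
        using K by (intro mult_left_mono) auto
      ultimately show False
        using up y(1) by linarith
    qed
    then show ?case
      by (simp add: K_def y_def j(2) iterated_log2_Suc)
  qed
  then show ?thesis
    unfolding a_def by (intro exI[of _ "\<lambda>_. 0"]) simp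
qed

end
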